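(* For integers $r\ge 1$, $t\ge 2$, $y\ge \max\{r,2\}$, $z\ge 0$ with $\lambda=q^{y}$, $y\le k$, $k=\frac{q^r-1}{q-1}+1-z>r$, $v=kt+r$, and $l=\frac{q^{v-k}-q^r}{q^k-1}$, we have $$\mathrm{A}_q(v,2k;k)\le lq^k+\left\lceil \lambda -\frac{1}{2}-\frac{1}{2}\sqrt{1+4\lambda\left(\lambda-(z+y-1)(q-1)-1\right)} \right\rceil.$$
   Context: $q>1$ is a prime power. $\mathrm{A}_q(v,2k;k)$ denotes the maximum size of a partial $k$-spread in $\mathbb{F}_q^v$, i.e. of a set of $k$-dimensional subspaces of $\mathbb{F}_q^v$ with pairwise trivial (zero) intersection. *)

theory Defs
  imports "HOL-Analysis.Cartesian_Space"
begin

definition partial_spread :: "nat \<Rightarrow> ('a::field ^ 'n) set set \<Rightarrow> bool" where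
  "partial_spread k S \<longleftrightarrow>
     (\<forall>U\<in>S. vec.subspace U \<and> vec.dim U = k) \<and> pairwise (\<lambda>U W. U \<inter> W = {0}) S"

text \<open>
  The number \<open>A\<^sub>q(v,2k;k)\<close>, where \<open>q = CARD('a)\<close> and \<open>v = CARD('n)\<close> are read off
  from the ambient space \<open>'a ^ 'n\<close>. A finite field has prime power order, and every
  finite field of order \<open>q\<close> is isomorphic to any other one, so the number depends on
  \<open>q\<close>, \<open>v\<close> and \<open>k\<close> only. The maximum is taken over a finite nonempty set, since
  the ambient space is finite and the empty set is a partial spread.
\<close>
definition A_spread :: "('a::{field,finite} ^ 'n) itself \<Rightarrow> nat \<Rightarrow> nat" where
  "A_spread _ k = Max {card S | S :: ('a ^ 'n) set set. partial_spread k S}"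

end

theory Submission
  imports Defs
begin

text \<open>
  Count the nonzero vectors lying in no element of a partial spread of size
  \<open>l q\<^sup>k + X + 1\<close>. Inside a subspace of codimension at most \<open>j\<close> their number is congruent to
  \<open>X\<close> modulo \<open>q\<^bsup>k-j\<^esup>\<close>. Cutting \<open>k - y\<close> times with a hyperplane that carries at most the
  average leaves a set \<open>C\<close> of size \<open>m \<lambda> + X\<close> with \<open>m\<close> small. All intersections of \<open>C\<close> with
  hyperplanes have congruent sizes modulo \<open>q\<^bsup>y-1\<^esup>\<close>, so a second moment count over all
  linear functionals gives \<open>X (X + 1 - \<lambda>) + m \<lambda> > 0\<close>. Substituting the bound for \<open>m\<close>
  yields a quadratic inequality in \<open>X\<close>, which fails between its roots.
\<close>

section \<open>Hyperplanes and cardinalities of subspaces over a finite field\<close>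

definition dot :: "'a::field ^ 'n::finite \<Rightarrow> 'a ^ 'n \<Rightarrow> 'a" where
  "dot a p = (\<Sum>i\<in>UNIV. a $ i * p $ i)"

lemma dot_commute: "dot a p = dot p a"
  by (simp add: dot_def mult.commute)

lemma dot_zero [simp]: "dot a 0 = 0" "dot 0 a = 0"
  by (simp_all add: dot_def)

lemma dot_add: "dot a (x + y) = dot a x + dot a y"
  by (simp add: dot_def distrib_left sum.distrib)

lemma dot_scale: "dot a (c *s x) = c * dot a x"
  by (simp add: dot_def sum_distrib_left mult_ac)

lemma dot_diff: "dot a (x - y) = dot a x - dot a y"
  by (simp add: dot_def right_diff_distrib sum_subtractf)

lemma dot_axis: "dot (axis i c) p = c * p $ i"
proof -
  have "dot (axis i c) p = (\<Sum>j\<in>UNIV. if j = i then c * p $ j else 0)"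
    unfolding dot_def by (rule sum.cong) (auto simp: axis_def)
  then show ?thesis by simp
qed

text \<open>Over a field with \<open>q\<close> elements, indexing by all vectors \<open>a\<close>
  counts every hyperplane \<open>q - 1\<close> times and adds the whole space at
  \<open>a = 0\<close>, so averages can run over \<open>UNIV\<close> without a projective
  quotient.\<close>

definition perp :: "'a::field ^ 'n::finite \<Rightarrow> ('a ^ 'n) set" where
  "perp a = {p. dot a p = 0}"

lemma subspace_perp: "vec.subspace (perp a)"
  by (auto simp: vec.subspace_def perp_def dot_add dot_scale)

lemma mem_perp_commute: "p \<in> perp a \<longleftrightarrow> a \<in> perp p"
  by (simp add: perp_def dot_commute)

lemma perp_0 [simp]: "perp 0 = UNIV"
  by (simp add: perp_def)

text \<open>A vector \<open>u\<close> of \<open>U\<close> outside \<open>perp a\<close> splits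
  \<open>U\<close> into the disjoint translates of \<open>U \<inter> perp a\<close> by the multiples
  of \<open>u\<close>.\<close>

lemma card_subspace_inter_perp:
  fixes U :: "('a::{field,finite} ^ 'n::finite) set"
  assumes U: "vec.subspace U" and "\<not> U \<subseteq> perp a"
  shows "card U = CARD('a) * card (U \<inter> perp a)"
proof -
  obtain u where u: "u \<in> U" "dot a u \<noteq> 0"
    using assms(2) by (auto simp: perp_def)
  let ?f = "\<lambda>(c, p). c *s u + p"
  have "bij_betw ?f ((UNIV :: 'a set) \<times> (U \<inter> perp a)) U"
  proof (rule bij_betwI')
    fix x y :: "'a \<times> ('a ^ 'n)" assume *: "x \<in> UNIV \<times> (U \<inter> perp a)" "y \<in> UNIV \<times> (U \<inter> perp a)"
    obtain c p d w where [simp]: "x = (c, p)" "y = (d, w)" by fastforce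
    have "dot a p = 0" "dot a w = 0" using * by (auto simp: perp_def)
    show "?f x = ?f y \<longleftrightarrow> x = y"
    proof
      assume e: "?f x = ?f y"
      then have "dot a (c *s u + p) = dot a (d *s u + w)" by simp
      then have "c * dot a u = d * dot a u"
        using \<open>dot a p = 0\<close> \<open>dot a w = 0\<close> by (simp add: dot_add dot_scale)
      then have "c = d" using u by simp
      then show "x = y" using e by simp
    qed simp
  next
    fix x assume "x \<in> (UNIV :: 'a set) \<times> (U \<inter> perp a)"
    then show "?f x \<in> U" using U u by (auto simp: vec.subspace_def)
  next
    fix w assume w: "w \<in> U"
    let ?c = "dot a w / dot a u"
    have "w - ?c *s u \<in> U" using U u w by (simp add: vec.subspace_diff vec.subspace_scale)
    moreover have "dot a (w - ?c *s u) = 0" using u by (simp add: dot_diff dot_scale)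
    ultimately have "(?c, w - ?c *s u) \<in> (UNIV :: 'a set) \<times> (U \<inter> perp a)" by (simp add: perp_def)
    moreover have "w = ?f (?c, w - ?c *s u)" by simp
    ultimately show "\<exists>x\<in>(UNIV :: 'a set) \<times> (U \<inter> perp a). w = ?f x" by blast
  qed
  then show ?thesis by (metis bij_betw_same_card card_cartesian_product)
qed

lemma card_span_independent:
  fixes B :: "('a::{field,finite} ^ 'n::finite) set"
  assumes "vec.independent B"
  shows "card (vec.span B) = CARD('a) ^ card B"
  using finite[of B] assms
proof (induction B)
  case empty
  then show ?case by simp
next
  case (insert b B)
  have ind: "vec.independent B" and nb: "b \<notin> vec.span B"
    using insert.prems insert.hyps by (simp_all add: vec.independent_insert)
  let ?f = "\<lambda>(c, p). c *s b + p"
  have "bij_betw ?f ((UNIV :: 'a set) \<times> vec.span B) (vec.span (insert b B))"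
  proof (rule bij_betwI')
    fix x y :: "'a \<times> ('a ^ 'n)" assume *: "x \<in> UNIV \<times> vec.span B" "y \<in> UNIV \<times> vec.span B"
    obtain c p d w where [simp]: "x = (c, p)" "y = (d, w)" by fastforce
    show "?f x = ?f y \<longleftrightarrow> x = y"
    proof
      assume e: "?f x = ?f y"
      have "(c - d) *s b = w - p"
        using e by (simp add: vec.scale_left_diff_distrib algebra_simps)
      moreover have "w - p \<in> vec.span B" using * by (auto intro: vec.span_diff)
      ultimately have "c = d" using nb
        by (metis right_minus_eq vec.span_scale vec.scale_scale left_inverse vec.scale_one)
      then show "x = y" using e by simp
    qed simp
  next
    fix x assume "x \<in> (UNIV :: 'a set) \<times> vec.span B"
    then obtain c p where x: "x = (c, p)" "p \<in> vec.span B" by auto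
    then have "c *s b + p - c *s b \<in> vec.span B" by simp
    then show "?f x \<in> vec.span (insert b B)" unfolding x vec.span_insert prod.case by blast
  next
    fix w assume "w \<in> vec.span (insert b B)"
    then obtain c where "w - c *s b \<in> vec.span B" by (auto simp: vec.span_insert)
    then show "\<exists>x\<in>(UNIV :: 'a set) \<times> vec.span B. w = ?f x"
      by (intro bexI[of _ "(c, w - c *s b)"]) auto
  qed
  then have "card (vec.span (insert b B)) = CARD('a) * card (vec.span B)"
    by (metis bij_betw_same_card card_cartesian_product)
  then show ?case using insert ind by simp
qed

lemma card_subspace:
  fixes U :: "('a::{field,finite} ^ 'n::finite) set"
  assumes "vec.subspace U"
  shows "card U = CARD('a) ^ vec.dim U"
proof -
  obtain B where B: "B \<subseteq> U" "vec.independent B" "U \<subseteq> vec.span B" "card B = vec.dim U"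
    using vec.basis_exists by blast
  then have "vec.span B = U"
    using assms by (metis vec.span_subspace)
  then show ?thesis using B card_span_independent by metis
qed

lemma card_field_gt_1: "CARD('a::{field,finite}) > 1"
proof -
  have "card {0, 1 :: 'a} \<le> CARD('a)" by (rule card_mono) auto
  then show ?thesis by simp
qed

section \<open>Iterated hyperplane sections\<close>

text \<open>The vectors of the list may be zero, repeated or dependent, so its length only bounds
  the codimension from above. Divisibility by powers of \<open>CARD('a)\<close> therefore replaces
  exact dimensions.\<close>

definition complement_of :: "('a::field ^ 'n::finite) list \<Rightarrow> ('a ^ 'n) set" where
  "complement_of as = (\<Inter>a\<in>set as. perp a)"

lemma complement_of_simps:
  "complement_of [] = UNIV" "complement_of (a # as) = perp a \<inter> complement_of as"
  by (simp_all add: complement_of_def)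

lemma subspace_complement_of: "vec.subspace (complement_of as)"
  unfolding complement_of_def by (rule vec.subspace_Int) (simp add: subspace_perp)

text \<open>Each further hyperplane either contains the current section or divides its size by
  \<open>CARD('a)\<close>, so at most one factor is lost per cut. Truncated subtraction makes the
  claim trivial once the list has length at least \<open>d\<close>.\<close>

lemma card_inter_complement_of_dvd:
  fixes U :: "('a::{field,finite} ^ 'n::finite) set"
  assumes U: "vec.subspace U" and "CARD('a) ^ d dvd card U"
  shows "CARD('a) ^ (d - length as) dvd card (U \<inter> complement_of as)"
proof (induction as)
  case Nil
  then show ?case using assms by (simp add: complement_of_simps)
next
  case (Cons a as)
  let ?V = "U \<inter> complement_of as"
  have V: "vec.subspace ?V" using U subspace_complement_of by (rule vec.subspace_inter)
  have e: "U \<inter> complement_of (a # as) = ?V \<inter> perp a" by (auto simp: complement_of_simps)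
  show ?case
  proof (cases "?V \<subseteq> perp a")
    case True
    then have "?V \<inter> perp a = ?V" by blast
    moreover have "CARD('a) ^ (d - length (a # as)) dvd CARD('a) ^ (d - length as)"
      by (rule le_imp_power_dvd) simp
    ultimately show ?thesis using Cons e by (metis dvd_trans)
  next
    case False
    then have c: "card ?V = CARD('a) * card (?V \<inter> perp a)"
      by (rule card_subspace_inter_perp[OF V])
    show ?thesis
    proof (cases "d - length as")
      case 0
      then show ?thesis by simp
    next
      case (Suc e')
      then have "CARD('a) * CARD('a) ^ e' dvd CARD('a) * card (?V \<inter> perp a)"
        using Cons c by simp
      then have "CARD('a) ^ e' dvd card (?V \<inter> perp a)"
        using card_field_gt_1[where 'a='a] by (subst (asm) dvd_times_left_cancel_iff) auto
      moreover have "d - length (a # as) = e'" using Suc by simp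
      ultimately show ?thesis using e by simp
    qed
  qed
qed

section \<open>Sets closed under nonzero scalars\<close>

text \<open>A set of points of projective space in vector form: a union of lines through the origin
  with the origin removed.\<close>

definition punctured_cone :: "('a::field ^ 'n) set \<Rightarrow> bool" where
  "punctured_cone C \<longleftrightarrow> 0 \<notin> C \<and> (\<forall>p\<in>C. \<forall>c. c \<noteq> 0 \<longrightarrow> c *s p \<in> C)"

lemma punctured_cone_Int_subspace:
  "punctured_cone C \<Longrightarrow> vec.subspace U \<Longrightarrow> punctured_cone (C \<inter> U)"
  by (auto simp: punctured_cone_def vec.subspace_def)

lemma card_multiples:
  fixes p :: "'a::{field,finite} ^ 'n::finite"
  assumes "p \<noteq> 0"
  shows "card ((\<lambda>c. c *s p) ` (UNIV - {0})) = CARD('a) - 1"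
proof -
  have "inj_on (\<lambda>c. c *s p) (UNIV - {0})"
    using assms by (auto simp: inj_on_def)
  then show ?thesis by (simp add: card_image)
qed

text \<open>Proportionality partitions the cone into classes, each consisting of the
  \<open>CARD('a) - 1\<close> nonzero multiples of one vector.\<close>

lemma punctured_cone_card_dvd:
  fixes C :: "('a::{field,finite} ^ 'n::finite) set"
  assumes "punctured_cone C"
  shows "CARD('a) - 1 dvd card C"
proof -
  define R where "R = {(p, w). p \<in> C \<and> w \<in> C \<and> (\<exists>c. c \<noteq> 0 \<and> w = c *s p)}"
  have "equiv C R"
  proof (rule equivI)
    show "R \<subseteq> C \<times> C" by (auto simp: R_def)
    show "refl_on C R" by (auto simp: refl_on_def R_def intro!: exI[of _ 1])
    show "sym R"
    proof (rule symI)
      fix p w assume "(p, w) \<in> R"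
      then obtain c where c: "p \<in> C" "w \<in> C" "c \<noteq> 0" "w = c *s p" by (auto simp: R_def)
      then have "p = inverse c *s w" by (simp add: vector_smult_assoc)
      then show "(w, p) \<in> R" using c by (auto simp: R_def intro!: exI[of _ "inverse c"])
    qed
    show "trans R"
    proof (rule transI)
      fix p w u assume "(p, w) \<in> R" "(w, u) \<in> R"
      then obtain c d where "p \<in> C" "u \<in> C" "c \<noteq> 0" "w = c *s p" "d \<noteq> 0" "u = d *s w"
        by (auto simp: R_def)
      then show "(p, u) \<in> R"
        by (auto simp: R_def vector_smult_assoc intro!: exI[of _ "d * c"])
    qed
  qed
  moreover have "CARD('a) - 1 dvd card X" if "X \<in> C // R" for X
  proof -
    obtain p where p: "p \<in> C" "X = R `` {p}" using \<open>X \<in> C // R\<close> by (rule quotientE)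
    then have "X = (\<lambda>c. c *s p) ` (UNIV - {0})"
      using assms by (auto simp: R_def punctured_cone_def)
    moreover have "p \<noteq> 0" using p assms by (auto simp: punctured_cone_def)
    ultimately show ?thesis using card_multiples[of p] by simp
  qed
  ultimately show ?thesis
    by (intro equiv_imp_dvd_card[of C R]) (auto simp: R_def)
qed

section \<open>Moments of the sizes of hyperplane sections\<close>

lemma card_perp:
  fixes p :: "'a::{field,finite} ^ 'n::finite"
  assumes "p \<noteq> 0"
  shows "CARD('a) * card (perp p) = CARD('a) ^ CARD('n)"
proof -
  obtain i where "p $ i \<noteq> 0" using assms by (auto simp: vec_eq_iff)
  then have "axis i 1 \<notin> perp p" by (simp add: perp_def dot_commute[of p] dot_axis)
  then have "\<not> UNIV \<subseteq> perp p" by blast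
  then show ?thesis using card_subspace_inter_perp[of UNIV p] by (simp add: CARD_vec)
qed

text \<open>Non-proportional vectors impose independent conditions on a functional. The square
  factor stays on the left to avoid the truncated exponent \<open>CARD('n) - 2\<close>.\<close>

lemma card_perp_Int_perp:
  fixes p :: "'a::{field,finite} ^ 'n::finite"
  assumes "p \<noteq> 0" "w \<noteq> 0" "w \<notin> (\<lambda>c. c *s p) ` (UNIV - {0})"
  shows "CARD('a)\<^sup>2 * card (perp p \<inter> perp w) = CARD('a) ^ CARD('n)"
proof -
  obtain i where i: "p $ i \<noteq> 0" using assms by (auto simp: vec_eq_iff)
  have "\<not> perp p \<subseteq> perp w"
  proof
    assume sub: "perp p \<subseteq> perp w"
    have "p $ i * w $ j = p $ j * w $ i" for j
    proof -
      \<comment> \<open>The product of \<open>?a\<close> with \<open>w\<close> is the minor of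
        \<open>p\<close> and \<open>w\<close> in the columns \<open>i\<close> and \<open>j\<close>,
        while its product with \<open>p\<close> cancels. Hence all minors through column
        \<open>i\<close> vanish and \<open>w\<close> is proportional to \<open>p\<close>.\<close>
      let ?a = "axis j (p $ i) - axis i (p $ j)"
      have "dot p ?a = 0"
        by (simp add: dot_diff dot_commute[of p] dot_axis mult.commute)
      then have "dot w ?a = 0" using sub by (auto simp: perp_def)
      then show ?thesis by (simp add: dot_diff dot_commute[of w] dot_axis)
    qed
    then have "w = (w $ i / p $ i) *s p" using i by (simp add: vec_eq_iff field_simps)
    moreover from this have "w $ i / p $ i \<noteq> 0" using assms(2) by (metis vec.scale_zero_left)
    ultimately show False using assms(3) by blast
  qed
  then have "card (perp p) = CARD('a) * card (perp p \<inter> perp w)"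
    by (rule card_subspace_inter_perp[OF subspace_perp])
  then show ?thesis using card_perp[OF assms(1)] by (simp add: power2_eq_square mult.assoc)
qed

text \<open>Count the pairs \<open>(a, p)\<close> with \<open>p \<in> C\<close> and
  \<open>dot a p = 0\<close> in both orders.\<close>

lemma sum_card_Int_perp:
  fixes C :: "('a::{field,finite} ^ 'n::finite) set"
  assumes "0 \<notin> C"
  shows "CARD('a) * (\<Sum>a\<in>UNIV. card (C \<inter> perp a)) = card C * CARD('a) ^ CARD('n)"
proof -
  have "(\<Sum>a\<in>UNIV. card (C \<inter> perp a)) = (\<Sum>a\<in>UNIV. \<Sum>p\<in>C. if p \<in> perp a then 1 else 0)"
    by (simp add: sum.If_cases)
  also have "\<dots> = (\<Sum>p\<in>C. \<Sum>a\<in>UNIV. if a \<in> perp p then 1 else 0)"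
    by (subst sum.swap) (simp add: mem_perp_commute)
  also have "\<dots> = (\<Sum>p\<in>C. card (perp p))"
    by (simp add: sum.If_cases)
  finally have "CARD('a) * (\<Sum>a\<in>UNIV. card (C \<inter> perp a)) = (\<Sum>p\<in>C. CARD('a) * card (perp p))"
    by (simp add: sum_distrib_left)
  also have "\<dots> = (\<Sum>p\<in>C. CARD('a) ^ CARD('n))"
    using assms by (intro sum.cong card_perp) auto
  finally show ?thesis by simp
qed

text \<open>Count triples \<open>(a, p, w)\<close> with \<open>a\<close> orthogonal to both
  \<open>p\<close> and \<open>w\<close>. For fixed \<open>p\<close>, the \<open>q - 1\<close>
  nonzero multiples \<open>w\<close> of \<open>p\<close> impose no new condition on
  \<open>a\<close>; every other \<open>w\<close> in \<open>C\<close> divides the number of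
  \<open>a\<close> by a further factor \<open>q\<close>.\<close>

lemma sum_card_Int_perp_squared:
  fixes C :: "('a::{field,finite} ^ 'n::finite) set"
  assumes "punctured_cone C"
  shows "(int (CARD('a)))\<^sup>2 * (\<Sum>a\<in>UNIV. (int (card (C \<inter> perp a)))\<^sup>2)
    = int (card C) * (int (CARD('a) - 1) * int (CARD('a)) + (int (card C) - int (CARD('a) - 1)))
      * int (CARD('a)) ^ CARD('n)"
proof -
  let ?q = "int (CARD('a))"
  let ?M = "\<lambda>p. (\<lambda>c. c *s p) ` (UNIV - {0 :: 'a})"
  have sq: "(int (card (C \<inter> perp a)))\<^sup>2
      = (\<Sum>p\<in>C. \<Sum>w\<in>C. if a \<in> perp p \<inter> perp w then 1 else 0)" for a
  proof -
    have "int (card (C \<inter> perp a)) = (\<Sum>p\<in>C. if a \<in> perp p then 1 else 0)"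
      by (simp add: sum.If_cases mem_perp_commute[of a] Int_def)
    then have "(int (card (C \<inter> perp a)))\<^sup>2
        = (\<Sum>p\<in>C. \<Sum>w\<in>C. (if a \<in> perp p then 1 else 0) * (if a \<in> perp w then 1 else 0))"
      by (simp only: power2_eq_square sum_product)
    also have "\<dots> = (\<Sum>p\<in>C. \<Sum>w\<in>C. if a \<in> perp p \<inter> perp w then 1 else 0)"
      by (intro sum.cong) auto
    finally show ?thesis .
  qed
  have "(\<Sum>a\<in>UNIV. (int (card (C \<inter> perp a)))\<^sup>2)
      = (\<Sum>p\<in>C. \<Sum>w\<in>C. \<Sum>a\<in>UNIV. if a \<in> perp p \<inter> perp w then 1 else 0)"
    unfolding sq by (subst sum.swap, rule sum.cong[OF refl], rule sum.swap)
  also have "\<dots> = (\<Sum>p\<in>C. \<Sum>w\<in>C. int (card (perp p \<inter> perp w)))"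
  proof (intro sum.cong refl)
    fix p w :: "'a ^ 'n"
    have "(\<Sum>a\<in>UNIV. if a \<in> perp p \<inter> perp w then 1 else 0) = (\<Sum>a\<in>perp p \<inter> perp w. (1::int))"
      using sum.inter_restrict[of UNIV "\<lambda>_. 1::int" "perp p \<inter> perp w"] by simp
    then show "(\<Sum>a\<in>UNIV. if a \<in> perp p \<inter> perp w then 1 else 0)
      = int (card (perp p \<inter> perp w))" by simp
  qed
  finally have "?q\<^sup>2 * (\<Sum>a\<in>UNIV. (int (card (C \<inter> perp a)))\<^sup>2)
      = (\<Sum>p\<in>C. \<Sum>w\<in>C. ?q\<^sup>2 * int (card (perp p \<inter> perp w)))"
    by (simp add: sum_distrib_left)
  also have "\<dots> = (\<Sum>p\<in>C. (int (CARD('a) - 1) * ?q + (int (card C) - int (CARD('a) - 1)))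
      * ?q ^ CARD('n))"
  proof (intro sum.cong refl)
    fix p assume p: "p \<in> C"
    have p0: "p \<noteq> 0" and M: "?M p \<subseteq> C" using p assms by (auto simp: punctured_cone_def)
    have cM: "card (?M p) = CARD('a) - 1" by (rule card_multiples[OF p0])
    have "?q\<^sup>2 * int (card (perp p \<inter> perp w)) = ?q * ?q ^ CARD('n)" if "w \<in> ?M p" for w
    proof -
      have "perp w = perp p" using that by (auto simp: perp_def dot_commute dot_scale)
      moreover have "?q * int (card (perp p)) = ?q ^ CARD('n)"
        using card_perp[OF p0] by (metis of_nat_mult of_nat_power)
      ultimately show ?thesis by (simp add: power2_eq_square)
    qed
    moreover have "?q\<^sup>2 * int (card (perp p \<inter> perp w)) = ?q ^ CARD('n)"
      if "w \<in> C - ?M p" for w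
    proof -
      have "w \<noteq> 0" using that assms by (auto simp: punctured_cone_def)
      then have "CARD('a)\<^sup>2 * card (perp p \<inter> perp w) = CARD('a) ^ CARD('n)"
        using card_perp_Int_perp[OF p0] that by blast
      then show ?thesis by (metis of_nat_mult of_nat_power)
    qed
    ultimately have "(\<Sum>w\<in>C. ?q\<^sup>2 * int (card (perp p \<inter> perp w)))
        = (\<Sum>w\<in>C - ?M p. ?q ^ CARD('n)) + (\<Sum>w\<in>?M p. ?q * ?q ^ CARD('n))"
      using sum.subset_diff[OF M, of "\<lambda>w. ?q\<^sup>2 * int (card (perp p \<inter> perp w))"]
      by (simp del: sum_constant)
    also have "\<dots> = (int (card C) - int (CARD('a) - 1)) * ?q ^ CARD('n)
        + int (CARD('a) - 1) * (?q * ?q ^ CARD('n))"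
      using cM card_mono[OF finite M] by (simp add: card_Diff_subset[OF finite M] of_nat_diff)
    finally show "(\<Sum>w\<in>C. ?q\<^sup>2 * int (card (perp p \<inter> perp w)))
      = (int (CARD('a) - 1) * ?q + (int (card C) - int (CARD('a) - 1))) * ?q ^ CARD('n)"
      by (simp add: algebra_simps)
  qed
  finally show ?thesis by simp
qed

text \<open>Over all \<open>a\<close>, including \<open>a = 0\<close>, the average of
  \<open>card (C \<inter> perp a)\<close> is exactly \<open>card C / CARD('a)\<close>, so some value
  does not exceed it.\<close>

lemma exists_light_perp:
  fixes C :: "('a::{field,finite} ^ 'n::finite) set"
  assumes "0 \<notin> C"
  shows "\<exists>a. CARD('a) * card (C \<inter> perp a) \<le> card C"
proof (rule ccontr)
  assume "\<not> ?thesis"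
  then have "(\<Sum>a::'a^'n\<in>UNIV. card C) < (\<Sum>a\<in>UNIV. CARD('a) * card (C \<inter> perp a))"
    by (intro sum_strict_mono) (auto simp: not_le)
  then show False
    using sum_card_Int_perp[OF assms] by (simp add: sum_distrib_left[symmetric] CARD_vec)
qed

text \<open>
  The values \<open>card C - card (C \<inter> perp a)\<close> are multiples of \<open>G\<close>, so they avoid the
  open interval between \<open>m * G\<close> and \<open>(m + 1) * G\<close>; the left-hand side is the term at \<open>a = 0\<close>.
\<close>
lemma second_moment_bound:
  fixes C :: "('a::{field,finite} ^ 'n::finite) set" and G m :: int
  defines "q \<equiv> int (CARD('a))" and "c \<equiv> int (card C)"
  assumes cone: "punctured_cone C"
    and dvd: "\<And>a. G dvd c - int (card (C \<inter> perp a))"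
  shows "q\<^sup>2 * (m * (m + 1) * G\<^sup>2)
    \<le> q ^ CARD('n) * ((q - 1)\<^sup>2 * (c * (c + 1)) - (2 * m + 1) * (q - 1) * q * G * c
        + m * (m + 1) * q\<^sup>2 * G\<^sup>2)"
proof -
  define Z where "Z = (\<lambda>a. int (card (C \<inter> perp a)))"
  define F where "F = (\<lambda>a. (c - Z a - m * G) * (c - Z a - (m + 1) * G))"
  have nonneg: "0 \<le> F a" for a
  proof -
    obtain i where "c - Z a = G * i" using dvd[of a] by (auto simp: Z_def)
    \<comment> \<open>Up to the factor \<open>G^2\<close> this is a product of two consecutive
      integers, hence never negative.\<close>
    then have "F a = G\<^sup>2 * ((i - m) * (i - (m + 1)))"
      by (simp add: F_def power2_eq_square algebra_simps)
    moreover have "0 \<le> (i - m) * (i - (m + 1))"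
      by (cases "i \<le> m") (auto intro: mult_nonpos_nonpos mult_nonneg_nonneg)
    ultimately show ?thesis by simp
  qed
  have "m * (m + 1) * G\<^sup>2 = F 0"
    by (simp add: F_def Z_def c_def power2_eq_square algebra_simps)
  also have "F 0 \<le> (\<Sum>a\<in>UNIV. F a)"
    by (rule member_le_sum) (auto simp: nonneg)
  finally have "q\<^sup>2 * (m * (m + 1) * G\<^sup>2) \<le> q\<^sup>2 * (\<Sum>a\<in>UNIV. F a)"
    by (rule mult_left_mono) simp
  also have "(\<Sum>a\<in>UNIV. F a) = (\<Sum>a\<in>UNIV. (Z a)\<^sup>2)
      - (2 * c - (2 * m + 1) * G) * (\<Sum>a\<in>UNIV. Z a)
      + q ^ CARD('n) * ((c - m * G) * (c - (m + 1) * G))"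
  proof -
    have "F a = (Z a)\<^sup>2 - (2 * c - (2 * m + 1) * G) * Z a + (c - m * G) * (c - (m + 1) * G)" for a
      by (simp add: F_def power2_eq_square algebra_simps)
    then show ?thesis
      by (simp add: sum.distrib sum_subtractf sum_distrib_left CARD_vec q_def)
  qed
  also have "q\<^sup>2 * \<dots> = q\<^sup>2 * (\<Sum>a\<in>UNIV. (Z a)\<^sup>2)
      - (2 * c - (2 * m + 1) * G) * q * (q * (\<Sum>a\<in>UNIV. Z a))
      + q\<^sup>2 * q ^ CARD('n) * ((c - m * G) * (c - (m + 1) * G))"
    by (simp add: power2_eq_square algebra_simps)
  also have "q\<^sup>2 * (\<Sum>a\<in>UNIV. (Z a)\<^sup>2) = c * ((q - 1) * q + (c - (q - 1))) * q ^ CARD('n)"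
    using sum_card_Int_perp_squared[OF cone] card_field_gt_1[where 'a='a]
    by (simp add: q_def c_def Z_def of_nat_diff)
  also have "q * (\<Sum>a\<in>UNIV. Z a) = c * q ^ CARD('n)"
  proof -
    have "0 \<notin> C" using cone by (simp add: punctured_cone_def)
    from arg_cong[OF sum_card_Int_perp[OF this], of int] show ?thesis
      by (simp add: q_def c_def Z_def)
  qed
  finally show ?thesis by (simp add: power2_eq_square algebra_simps)
qed

text \<open>Instance \<open>G = (q - 1) * q ^ e\<close> of the second moment bound: the cone
  property supplies the divisor \<open>q - 1\<close>, the hypothesis the coprime divisor
  \<open>q ^ e\<close>, and a common factor \<open>q ^ CARD('n) * (q - 1)^2\<close> cancels. For
  \<open>m \<ge> 1\<close> the term at \<open>a = 0\<close> is positive, hence the strict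
  inequality.\<close>

lemma cone_quadratic_bound:
  fixes C :: "('a::{field,finite} ^ 'n::finite) set" and m :: int
  defines "q \<equiv> int (CARD('a))" and "c \<equiv> int (card C)"
  assumes cone: "punctured_cone C"
    and dvd: "\<And>a. q ^ e dvd c - int (card (C \<inter> perp a))"
  shows "m \<ge> 0 \<Longrightarrow> c * (c + 1) - (2 * m + 1) * q ^ Suc e * c + m * (m + 1) * (q ^ Suc e)\<^sup>2 \<ge> 0"
    and "m \<ge> 1 \<Longrightarrow> c * (c + 1) - (2 * m + 1) * q ^ Suc e * c + m * (m + 1) * (q ^ Suc e)\<^sup>2 > 0"
proof -
  let ?G = "(q - 1) * q ^ e"
  let ?t = "c * (c + 1) - (2 * m + 1) * q ^ Suc e * c + m * (m + 1) * (q ^ Suc e)\<^sup>2"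
  have q: "q > 1" using card_field_gt_1[where 'a='a] by (simp add: q_def)
  have "?G dvd c - int (card (C \<inter> perp a))" for a
  proof (rule divides_mult)
    have "CARD('a) - 1 dvd card C" "CARD('a) - 1 dvd card (C \<inter> perp a)"
      using cone punctured_cone_Int_subspace[OF cone subspace_perp]
      by (blast intro: punctured_cone_card_dvd)+
    then show "q - 1 dvd c - int (card (C \<inter> perp a))"
      using q unfolding q_def c_def
      by (intro dvd_diff) (metis int_dvd_int_iff of_nat_1 of_nat_diff card_field_gt_1 less_imp_le)+
    show "q ^ e dvd c - int (card (C \<inter> perp a))" by (rule dvd)
    show "coprime (q - 1) (q ^ e)" by (simp add: coprime_diff_one_left)
  qed
  from second_moment_bound[OF cone this[unfolded q_def c_def], folded q_def c_def, of m]
  have "q\<^sup>2 * (m * (m + 1) * ?G\<^sup>2) \<le> (q ^ CARD('n) * (q - 1)\<^sup>2) * ?t"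
    by (simp add: power2_eq_square algebra_simps)
  moreover have pos: "q ^ CARD('n) * (q - 1)\<^sup>2 > 0" using q by simp
  moreover have "q\<^sup>2 * (m * (m + 1) * ?G\<^sup>2) \<ge> 0" if "m \<ge> 0" using that q by simp
  moreover have "q\<^sup>2 * (m * (m + 1) * ?G\<^sup>2) > 0" if "m \<ge> 1" using that q by simp
  ultimately show "m \<ge> 0 \<Longrightarrow> ?t \<ge> 0" "m \<ge> 1 \<Longrightarrow> ?t > 0"
    by (meson order.trans zero_le_mult_iff not_le, meson less_le_trans zero_less_mult_pos)
qed

section \<open>Holes of a partial spread\<close>

text \<open>Zero is inserted explicitly so that it is not a hole even when \<open>S\<close> is
  empty, which keeps the set a punctured cone.\<close>

definition holes :: "('a::field ^ 'n) set set \<Rightarrow> ('a ^ 'n) set" where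
  "holes S = - insert 0 (\<Union>S)"

lemma punctured_cone_holes:
  fixes S :: "('a::field ^ 'n) set set"
  assumes "\<forall>U\<in>S. vec.subspace U"
  shows "punctured_cone (holes S)"
proof -
  have "p \<in> U" if "c *s p \<in> U" "c \<noteq> 0" "U \<in> S" for c :: 'a and p U
  proof -
    have "inverse c *s (c *s p) \<in> U" using that assms by (simp only: vec.subspace_scale)
    then show ?thesis using that by (simp add: vector_smult_assoc)
  qed
  then show ?thesis by (auto simp: punctured_cone_def holes_def)
qed

text \<open>Spread elements meet only in zero, so the nonzero vectors of \<open>T\<close> split
  disjointly into holes and the nonzero parts of the sections \<open>U \<inter> T\<close>.\<close>

lemma card_holes_Int:
  fixes S :: "('a::{field,finite} ^ 'n::finite) set set"
  assumes S: "partial_spread k S" and T: "vec.subspace T"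
  shows "int (card (holes S \<inter> T)) = int (card T) - 1 - (\<Sum>U\<in>S. int (card (U \<inter> T)) - 1)"
proof -
  have sub: "0 \<in> T" "\<And>U. U \<in> S \<Longrightarrow> 0 \<in> U"
    using S T by (auto simp: partial_spread_def vec.subspace_def)
  have T_eq: "T - {0} = (holes S \<inter> T) \<union> (\<Union>U\<in>S. U \<inter> T - {0})"
    by (auto simp: holes_def)
  have "card (T - {0}) = card (holes S \<inter> T) + card (\<Union>U\<in>S. U \<inter> T - {0})"
    unfolding T_eq by (rule card_Un_disjoint) (auto simp: holes_def)
  also have "card (\<Union>U\<in>S. U \<inter> T - {0}) = (\<Sum>U\<in>S. card (U \<inter> T - {0}))"
    using S by (intro card_UN_disjoint) (auto simp: partial_spread_def pairwise_def)
  finally have "int (card (T - {0})) = int (card (holes S \<inter> T)) + (\<Sum>U\<in>S. int (card (U \<inter> T - {0})))"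
    by simp
  moreover have "int (card (A - {0})) = int (card A) - 1" if "0 \<in> A" for A :: "('a ^ 'n) set"
  proof -
    have "card A > 0" using that by (auto simp: card_gt_0_iff)
    then show ?thesis using that by (simp add: of_nat_diff)
  qed
  ultimately show ?thesis using sub by simp
qed

text \<open>Modulo the given power, the sizes of the section and of its intersections with spread
  elements vanish; only the corrections for the zero vector, \<open>card S - 1\<close>,
  remain.\<close>

lemma card_holes_complement_dvd:
  fixes S :: "('a::{field,finite} ^ 'n::finite) set set"
  assumes S: "partial_spread k S" and "k \<le> CARD('n)"
  shows "int (CARD('a)) ^ (k - length as)
    dvd int (card (holes S \<inter> complement_of as)) - (int (card S) - 1)"
proof -
  let ?d = "int (CARD('a)) ^ (k - length as)"
  have d: "?d dvd int (card (U \<inter> complement_of as))"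
    if "vec.subspace U" "CARD('a) ^ k dvd card U" for U :: "('a ^ 'n) set"
    using card_inter_complement_of_dvd[OF that, of as]
    by (metis int_dvd_int_iff of_nat_power)
  have "?d dvd int (card (UNIV \<inter> complement_of as))"
    using assms(2) by (intro d) (simp_all add: CARD_vec le_imp_power_dvd)
  moreover have "?d dvd (\<Sum>U\<in>S. int (card (U \<inter> complement_of as)))"
    using S by (intro dvd_sum d) (auto simp: partial_spread_def card_subspace)
  ultimately show ?thesis
    unfolding card_holes_Int[OF S subspace_complement_of]
    by (simp add: sum_subtractf)
qed

text \<open>
  Each cut is by a hyperplane carrying at most the average number of holes. This lowers
  the coefficient of the leading power of \<open>q\<close> strictly, and hence by at least \<open>q - 1\<close>,
  because the number of nonzero hole vectors is a multiple of \<open>q - 1\<close>.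
\<close>
lemma light_complement:
  fixes S :: "('a::{field,finite} ^ 'n::finite) set set" and X s0 :: int
  defines "q \<equiv> int (CARD('a))"
  assumes S: "partial_spread k S" and kv: "k \<le> CARD('n)"
    and X: "X \<ge> 1" "q ^ k dvd int (card S) - 1 - X"
    and start: "int (card (holes S)) = s0 * q ^ k + X"
    and "j \<le> k"
  shows "\<exists>as s. length as = j \<and> int (card (holes S \<inter> complement_of as)) = s * q ^ (k - j) + X
    \<and> s \<le> s0 - (q - 1) * int j"
  using \<open>j \<le> k\<close>
proof (induction j)
  case 0
  then show ?case using start by (intro exI[of _ "[]"] exI[of _ s0]) (simp add: complement_of_simps)
next
  case (Suc j)
  have q: "q > 1" using card_field_gt_1[where 'a='a] by (simp add: q_def)
  have cone: "punctured_cone (holes S \<inter> complement_of bs)" for bs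
    using S by (intro punctured_cone_Int_subspace punctured_cone_holes subspace_complement_of)
      (auto simp: partial_spread_def)
  have q1_dvd: "q - 1 dvd int (card (holes S \<inter> complement_of bs))" for bs
    using punctured_cone_card_dvd[OF cone[of bs]] card_field_gt_1[where 'a='a] unfolding q_def
    by (metis int_dvd_int_iff of_nat_1 of_nat_diff less_imp_le)
  have q1_dvd_power: "q - 1 dvd q ^ i - 1" for i
    by (metis dvd_triv_left power_diff_1_eq)
  obtain as s where as: "length as = j" "int (card (holes S \<inter> complement_of as)) = s * q ^ (k - j) + X"
    and s: "s \<le> s0 - (q - 1) * int j"
    using Suc by auto
  obtain a where a: "CARD('a) * card (holes S \<inter> complement_of as \<inter> perp a)
      \<le> card (holes S \<inter> complement_of as)"
    using exists_light_perp cone unfolding punctured_cone_def by meson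
  \<comment> \<open>The hole count of the new section is congruent to \<open>X\<close>, so it keeps
    the shape \<open>s' * q ^ (k - Suc j) + X\<close>; a priori \<open>s'\<close> may be any
    integer.\<close>
  have "q ^ (k - Suc j) dvd int (card (holes S \<inter> complement_of (a # as))) - (int (card S) - 1)"
    using card_holes_complement_dvd[OF S kv, of "a # as"] as(1) by (simp add: q_def)
  moreover have "q ^ (k - Suc j) dvd int (card S) - 1 - X"
    using X(2) by (rule dvd_trans[OF le_imp_power_dvd, rotated]) simp
  ultimately have "q ^ (k - Suc j) dvd int (card (holes S \<inter> complement_of (a # as))) - X"
    by (metis (no_types, opaque_lifting) dvd_add diff_add_cancel add_diff_eq)
  then obtain s' where "int (card (holes S \<inter> complement_of (a # as))) - X = q ^ (k - Suc j) * s'"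
    by (rule dvdE)
  then have s': "int (card (holes S \<inter> complement_of (a # as))) = s' * q ^ (k - Suc j) + X"
    by (simp add: algebra_simps)
  have kj: "q ^ (k - j) = q * q ^ (k - Suc j)"
    using Suc.prems by (simp flip: power_Suc add: Suc_diff_Suc)
  have "holes S \<inter> complement_of as \<inter> perp a = holes S \<inter> complement_of (a # as)"
    by (auto simp: complement_of_simps)
  then have "q * int (card (holes S \<inter> complement_of (a # as)))
      \<le> int (card (holes S \<inter> complement_of as))"
    using a unfolding q_def by (metis of_nat_le_iff of_nat_mult)
  then have "s' * q ^ (k - j) + q * X \<le> s * q ^ (k - j) + X"
    unfolding s' as(2) kj by (simp add: algebra_simps)
  \<comment> \<open>\<open>X \<ge> 1\<close> turns the averaging inequality into a strict drop of
    the coefficient.\<close>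
  moreover have "X < q * X" using q X by simp
  ultimately have "s' * q ^ (k - j) < s * q ^ (k - j)" by linarith
  then have less: "s' < s" using q by simp
  \<comment> \<open>Since \<open>q\<close> is \<open>1\<close> modulo \<open>q - 1\<close>, each
    cone size reduces to its coefficient plus \<open>X\<close>, so the two coefficients are
    congruent modulo \<open>q - 1\<close>.\<close>
  have cong: "q - 1 dvd u + X" if "q - 1 dvd u * q ^ i + X" for u i
  proof -
    have "u + X = u * q ^ i + X - u * (q ^ i - 1)" by (simp add: algebra_simps)
    then show ?thesis using that q1_dvd_power by (metis dvd_diff dvd_mult)
  qed
  have "q - 1 dvd s + X" "q - 1 dvd s' + X"
    using q1_dvd[of as] q1_dvd[of "a # as"] cong unfolding as(2) s' by blast+
  then have "q - 1 dvd s - s'" by (metis dvd_diff add_diff_cancel_right)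
  then have "q - 1 \<le> s - s'" using less by (intro zdvd_imp_le) auto
  then have "s' \<le> s0 - (q - 1) * int (Suc j)" using s by (simp add: algebra_simps)
  then show ?case using s' as(1) by (intro exI[of _ "a # as"] exI[of _ s']) simp
qed

section \<open>Quadratic inequality for the excess\<close>

text \<open>Here \<open>w\<close> and \<open>L\<close> stand for \<open>v - k\<close> and
  \<open>l\<close>, and \<open>X + 1\<close> is the excess over \<open>L * q ^ k\<close>. The first
  bound holds because the total number of holes is nonnegative, the second by applying
  \<open>cone_quadratic_bound\<close> to a light section.\<close>

lemma partial_spread_excess_bounds:
  fixes S :: "('a::{field,finite} ^ 'n::finite) set set" and L X :: int
  defines "q \<equiv> int (CARD('a))"
  assumes S: "partial_spread k S" and v: "CARD('n) = k + w"
    and ry: "1 \<le> r" "r \<le> y" "y \<le> k" "r < k"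
    and L: "L * (q ^ k - 1) = q ^ w - q ^ r"
    and X: "int (card S) = L * q ^ k + X + 1" "X \<ge> 1"
  shows "X + 1 \<le> q ^ r"
    and "X\<^sup>2 - (2 * q ^ y - 1) * X + q ^ y * (q ^ r - 1 - (q - 1) * int (k - y)) > 0"
proof -
  have q: "q > 1" using card_field_gt_1[where 'a='a] by (simp add: q_def)
  have "int (card (holes S)) = q ^ (k + w) - 1 - int (card S) * (q ^ k - 1)"
  proof -
    have "(\<Sum>U\<in>S. int (card U) - 1) = (\<Sum>U\<in>S. q ^ k - 1)"
      using S by (intro sum.cong) (auto simp: partial_spread_def card_subspace q_def)
    then show ?thesis using card_holes_Int[OF S vec.subspace_UNIV] by (simp add: CARD_vec v q_def)
  qed
  also have "\<dots> = q ^ k * q ^ w - 1 - (L * (q ^ k - 1)) * q ^ k - (X + 1) * (q ^ k - 1)"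
    unfolding X by (simp add: power_add algebra_simps)
  also have "\<dots> = (q ^ r - 1 - X) * q ^ k + X"
    unfolding L by (simp add: algebra_simps)
  finally have start: "int (card (holes S)) = (q ^ r - 1 - X) * q ^ k + X" .
  \<comment> \<open>Otherwise the number of holes would be at most \<open>q ^ r - q ^ k\<close>,
    which is negative as \<open>r < k\<close>.\<close>
  show Xr: "X + 1 \<le> q ^ r"
  proof (rule ccontr)
    assume "\<not> ?thesis"
    then have "(X + 1 - q ^ r) * (q ^ k - 1) \<ge> 1 * (q ^ k - 1)"
      using q by (intro mult_right_mono) auto
    moreover have "q ^ r < q ^ k" using q ry by simp
    ultimately have "int (card (holes S)) < 0" unfolding start by (simp add: algebra_simps)
    then show False by simp
  qed
  obtain as m where as: "length as = k - y"
    and c: "int (card (holes S \<inter> complement_of as)) = m * q ^ y + X"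
    and m: "m \<le> q ^ r - 1 - X - (q - 1) * int (k - y)"
    using light_complement[OF S, of X "q ^ r - 1 - X" "k - y", folded q_def] X start v ry by auto
  have qr: "q ^ r \<le> q ^ y" using q ry by (intro power_increasing) auto
  \<comment> \<open>A negative \<open>m\<close> would make the hole count at most
    \<open>X - q ^ y\<close>, which is negative because
    \<open>X < q ^ r \<le> q ^ y\<close>.\<close>
  have m0: "m \<ge> 0"
  proof (rule ccontr)
    assume "\<not> ?thesis"
    then have "m * q ^ y \<le> (-1) * q ^ y" using q by (intro mult_right_mono) auto
    then show False using c Xr qr by linarith
  qed
  obtain e where e: "y = Suc e" using ry by (cases y) auto
  \<comment> \<open>One more hyperplane costs one factor of \<open>q\<close>: both sizes agree with
    \<open>card S - 1\<close> modulo \<open>q ^ e\<close>.\<close>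
  have dvd: "q ^ e dvd int (card (holes S \<inter> complement_of as))
      - int (card (holes S \<inter> complement_of as \<inter> perp a))" for a
  proof -
    have "k - length as = Suc e" "k - length (a # as) = e" using as ry e by auto
    then have "q ^ Suc e dvd int (card (holes S \<inter> complement_of as)) - (int (card S) - 1)"
      "q ^ e dvd int (card (holes S \<inter> complement_of (a # as))) - (int (card S) - 1)"
      using card_holes_complement_dvd[OF S, of as] card_holes_complement_dvd[OF S, of "a # as"] v
      by (simp_all add: q_def del: power_Suc)
    moreover from this(1) have "q ^ e dvd int (card (holes S \<inter> complement_of as)) - (int (card S) - 1)"
      by (auto elim: dvd_mult_right)
    moreover have "holes S \<inter> complement_of as \<inter> perp a = holes S \<inter> complement_of (a # as)"
      by (auto simp: complement_of_simps)
    ultimately show ?thesis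
      by (metis (no_types, lifting) dvd_diff diff_diff_eq2 diff_add_cancel)
  qed
  have cone: "punctured_cone (holes S \<inter> complement_of as)"
    using S by (intro punctured_cone_Int_subspace punctured_cone_holes subspace_complement_of)
      (auto simp: partial_spread_def)
  note quad = cone_quadratic_bound[OF cone dvd[unfolded q_def], folded q_def e, of m, unfolded c]
  \<comment> \<open>For \<open>m = 0\<close> the quadratic is \<open>X * (X + 1 - q ^ y)\<close>,
    which forces \<open>X + 1 = q ^ r = q ^ y\<close> and so \<open>y = r < k\<close>; then the
    upper bound on \<open>m\<close> is negative.\<close>
  have m1: "m \<ge> 1"
  proof (rule ccontr)
    assume "\<not> ?thesis"
    then have m_eq: "m = 0" using m0 by simp
    have "X * (X + 1 - q ^ y) \<ge> 0" using quad(1) m_eq by (simp add: algebra_simps)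
    then have "X + 1 \<ge> q ^ y" using X(2) by (simp add: zero_le_mult_iff)
    then have "q ^ r = q ^ y" and X_eq: "X + 1 = q ^ r" using Xr qr by auto
    then have "r = y" using q by simp
    then have "(q - 1) * int (k - y) > 0" using q ry by simp
    then show False using m m_eq X_eq by linarith
  qed
  \<comment> \<open>At \<open>c = m * q ^ y + X\<close> the terms in \<open>m^2\<close> and
    \<open>m * X\<close> cancel. What is left is linear in \<open>m\<close> with positive
    coefficient \<open>q ^ y\<close>, so the upper bound on \<open>m\<close> may be
    inserted.\<close>
  then have "X\<^sup>2 + X + m * q ^ y - q ^ y * X > 0"
    using quad(2) by (simp add: power2_eq_square algebra_simps)
  moreover have "m * q ^ y \<le> (q ^ r - 1 - X - (q - 1) * int (k - y)) * q ^ y"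
    using m q by (intro mult_right_mono) auto
  ultimately show "X\<^sup>2 - (2 * q ^ y - 1) * X + q ^ y * (q ^ r - 1 - (q - 1) * int (k - y)) > 0"
    by (simp add: algebra_simps)
qed

section \<open>From the quadratic inequality to the ceiling bound\<close>

text \<open>\<open>D\<close> is the discriminant of the quadratic, and the ceiling is taken of its
  smaller root when \<open>D \<ge> 0\<close>. If the claim fails, \<open>X\<close> is at least this
  root while \<open>X + 1 \<le> lam\<close> keeps it below the larger one, so the quadratic cannot
  be positive.\<close>

lemma ceiling_root_bound:
  fixes lam E X :: int
  defines "D \<equiv> 1 + 4 * real_of_int lam * (real_of_int lam - real_of_int E - 1)"
  assumes "E \<ge> 1" "lam \<ge> 1"
    and excess: "X \<ge> 1 \<Longrightarrow> X + 1 \<le> lam"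
      "X \<ge> 1 \<Longrightarrow> X\<^sup>2 - (2 * lam - 1) * X + lam * E > 0"
  shows "X + 1 \<le> \<lceil>real_of_int lam - 1 / 2 - 1 / 2 * sqrt D\<rceil>"
proof (rule ccontr)
  let ?u = "real_of_int lam - 1 / 2 - 1 / 2 * sqrt D"
  assume "\<not> ?thesis"
  then have Xu: "?u \<le> real_of_int X" by linarith
  \<comment> \<open>\<open>E \<ge> 1\<close> makes \<open>?u\<close> positive, which yields
    \<open>X \<ge> 1\<close> and so releases the conditional hypotheses.\<close>
  have "D < (2 * real_of_int lam - 1)\<^sup>2"
  proof -
    have "real_of_int lam * 1 \<le> real_of_int lam * real_of_int E"
      using assms by (intro mult_left_mono) auto
    then show ?thesis using assms(3) by (simp add: D_def power2_eq_square algebra_simps)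
  qed
  then have "sqrt D < 2 * real_of_int lam - 1"
    using assms(3) by (intro real_less_lsqrt) auto
  then have "?u > 0" by simp
  then have X1: "X \<ge> 1" using Xu by linarith
  have Xlam: "real_of_int X + 1 \<le> real_of_int lam" using excess(1)[OF X1] by linarith
  show False
  proof (cases "E + 1 \<le> lam")
    case True
    then have "D \<ge> 1" using assms(3) by (simp add: D_def)
    then have s: "(sqrt D)\<^sup>2 = D" "sqrt D \<ge> 1" by simp_all
    have "(real_of_int X - ?u) * (real_of_int X - (?u + sqrt D)) \<le> 0"
      using Xu Xlam s by (intro mult_nonneg_nonpos) auto
    moreover have "(real_of_int X - ?u) * (real_of_int X - (?u + sqrt D))
        = (real_of_int X - real_of_int lam + 1 / 2)\<^sup>2 - (sqrt D)\<^sup>2 / 4"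
      by (simp add: power2_eq_square field_simps)
    moreover have "\<dots> = real_of_int (X\<^sup>2 - (2 * lam - 1) * X + lam * E)"
      unfolding s by (simp add: D_def power2_eq_square field_simps)
    ultimately show False using excess(2)[OF X1] by linarith
  next
    case False
    \<comment> \<open>In HOL \<open>sqrt\<close> is an odd function, so \<open>D \<le> 0\<close>
      gives \<open>sqrt D \<le> 0\<close>. Then \<open>?u\<close> is at least
      \<open>lam - 1 / 2\<close>, contradicting \<open>?u \<le> X \<le> lam - 1\<close>.\<close>
    then have "real_of_int lam * (real_of_int lam - real_of_int E - 1) \<le> real_of_int lam * (-1)"
      using assms(3) by (intro mult_left_mono) linarith+
    then have "D \<le> 0" using assms(3) unfolding D_def by simp
    then have "sqrt D \<le> 0" by simp
    then show False using Xu Xlam by linarith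
  qed
qed

theorem theorem10:
  fixes q r t y z k v :: nat and lam l :: real
  assumes "CARD('a::{field,finite}) = q"
    and "CARD('n::finite) = v"
    and "r \<ge> 1" and "t \<ge> 2" and "y \<ge> max r 2"
    and "lam = real q ^ y"
    and "y \<le> k"
    and "real k = (real q ^ r - 1) / (real q - 1) + 1 - real z" and "k > r"
    and "v = k * t + r"
    and "l = (real q ^ (v - k) - real q ^ r) / (real q ^ k - 1)"
  shows "real (A_spread TYPE('a ^ 'n) k)
    \<le> l * real q ^ k
      + real_of_int \<lceil>lam - 1 / 2
          - 1 / 2 * sqrt (1 + 4 * lam * (lam - (real z + real y - 1) * (real q - 1) - 1))\<rceil>"
proof -
  have q: "q > 1" using card_field_gt_1[where 'a='a] assms(1) by simp
  have vk: "v - k = k * (t - 1) + r" "v = k + (v - k)"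
    using assms(4,10) by (cases t; simp)+
  \<comment> \<open>\<open>l\<close> is an integer, because \<open>v - k = k * (t - 1) + r\<close>
    and \<open>q ^ k - 1\<close> divides \<open>(q ^ k) ^ (t - 1) - 1\<close>. The excess can thus
    be treated in \<open>int\<close>.\<close>
  obtain L :: int where L: "L * (int q ^ k - 1) = int q ^ (v - k) - int q ^ r"
  proof -
    have "(int q ^ k) - 1 dvd (int q ^ k) ^ (t - 1) - 1 ^ (t - 1)"
      by (metis dvd_triv_left power_diff_sumr2)
    then obtain M where "(int q ^ k) ^ (t - 1) - 1 = (int q ^ k - 1) * M" by (auto simp: dvd_def)
    then have "int q ^ r * M * (int q ^ k - 1) = int q ^ r * ((int q ^ k) ^ (t - 1) - 1)"
      by simp
    also have "\<dots> = int q ^ (v - k) - int q ^ r"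
      unfolding vk(1) power_add power_mult by (simp add: algebra_simps)
    finally show ?thesis by (rule that)
  qed
  have qk: "real q ^ k > 1" using q assms(9) by (intro one_less_power) auto
  have l: "l = real_of_int L"
  proof -
    have "real_of_int L * (real q ^ k - 1) = real q ^ (v - k) - real q ^ r"
      using arg_cong[OF L, of real_of_int] by simp
    then show ?thesis unfolding assms(11) using qk by (simp add: divide_eq_eq)
  qed
  have kz: "(int q - 1) * (int k + int z - 1) = int q ^ r - 1"
  proof -
    have "(real q - 1) * (real k + real z - 1) = real q ^ r - 1"
      using assms(8) q by (simp add: field_simps)
    then have "real_of_int ((int q - 1) * (int k + int z - 1)) = real_of_int (int q ^ r - 1)"
      by simp
    then show ?thesis by (simp only: of_int_eq_iff)
  qed
  define E where "E = (int z + int y - 1) * (int q - 1)"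
  \<comment> \<open>The hypothesis on \<open>k\<close>, cleared of denominators, identifies this
    part of the radicand with the constant in the quadratic inequality.\<close>
  have E: "E = int q ^ r - 1 - (int q - 1) * int (k - y)"
    using assms(7) unfolding kz[symmetric] E_def by (simp add: of_nat_diff algebra_simps)
  \<comment> \<open>Here \<open>y \<ge> 2\<close> enters, giving
    \<open>z + y - 1 \<ge> 1\<close>.\<close>
  have E1: "E \<ge> 1"
  proof -
    have "1 * 1 \<le> (int z + int y - 1) * (int q - 1)"
      using assms(5) q by (intro mult_mono) auto
    then show ?thesis by (simp add: E_def)
  qed
  have lam: "lam = real_of_int (int q ^ y)" using assms(6) by simp
  let ?R = "\<lceil>lam - 1 / 2 - 1 / 2 * sqrt (1 + 4 * lam * (lam - real_of_int E - 1))\<rceil>"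
  have bound: "int (card S) \<le> L * int q ^ k + ?R"
    if S: "partial_spread k S" for S :: "('a ^ 'n) set set"
  proof -
    define X where "X = int (card S) - L * int q ^ k - 1"
    have X: "int (card S) = L * int q ^ k + X + 1" by (simp add: X_def)
    have ry: "1 \<le> r" "r \<le> y" "y \<le> k" "r < k" using assms by auto
    note ex = partial_spread_excess_bounds[OF S, unfolded assms(1,2), OF vk(2) ry L X]
    have "int q ^ r \<le> int q ^ y" using q ry by (intro power_increasing) auto
    then have "X + 1 \<le> ?R"
      unfolding lam
    proof (intro ceiling_root_bound)
      show "X + 1 \<le> int q ^ y" if "X \<ge> 1" using ex(1)[OF that] \<open>int q ^ r \<le> int q ^ y\<close> by simp
      show "X\<^sup>2 - (2 * int q ^ y - 1) * X + int q ^ y * E > 0" if "X \<ge> 1"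
        using ex(2)[OF that] by (simp only: E)
    qed (use E1 q in auto)
    then show ?thesis using X by simp
  qed
  have "A_spread TYPE('a ^ 'n) k \<in> {card S | S :: ('a ^ 'n) set set. partial_spread k S}"
    unfolding A_spread_def
  proof (rule Max_in)
    have "{card S | S :: ('a ^ 'n) set set. partial_spread k S}
        = card ` {S :: ('a ^ 'n) set set. partial_spread k S}" by auto
    then show "finite {card S | S :: ('a ^ 'n) set set. partial_spread k S}" by simp
    have "partial_spread k ({} :: ('a ^ 'n) set set)" by (simp add: partial_spread_def)
    then show "{card S | S :: ('a ^ 'n) set set. partial_spread k S} \<noteq> {}" by blast
  qed
  then obtain S :: "('a ^ 'n) set set"
    where S: "A_spread TYPE('a ^ 'n) k = card S" "partial_spread k S" by auto
  have "real_of_int (int (card S)) \<le> real_of_int (L * int q ^ k + ?R)"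
    using bound[OF S(2)] by (simp only: of_int_le_iff)
  then show ?thesis unfolding S(1) l by (simp add: E_def)
qed

end
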